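(* Let $M^2: z=z(u,v)$, $(u,v)\in\mathcal D$, be a surface in $\mathbb R^4$ without flat points, let $p\in M^2$, and let $g_1, g_2$ be two tangents at $p$ determined by the nonzero tangent vectors $X_1=\lambda_1 z_u+\mu_1 z_v$ and $X_2=\lambda_2 z_u+\mu_2 z_v$. The quantity $\zeta_{g_1,g_2}$ is invariant under any change of the parameters on $M^2$.
   Context: $M^2: z=z(u,v)$, $(u,v)\in\mathcal D\subset\mathbb R^2$, is a smooth regular 2-dimensional surface in Euclidean $\mathbb R^4$, with tangent space $T_pM^2=\mathrm{span}\{z_u,z_v\}$. $E,F,G$ are the coefficients of the first fundamental form $I(\lambda,\mu)=E\lambda^2+2F\lambda\mu+G\mu^2$, and $W=\sqrt{EG-F^2}$. $\{e_1,e_2\}$ is an orthonormal normal frame field chosen so that $\{z_u,z_v,e_1,e_2\}$ is positively oriented in $\mathbb R^4$ (the same convention is applied to every parametrization). $\sigma$ is the vector-valued second fundamental tensor (normal part of the second derivative). The oriented area of the parallelogram of an ordered pair of normal vectors is $S(a^1e_1+a^2e_2,\;b^1e_1+b^2e_2)=a^1b^2-a^2b^1$. Put $L=\frac{2}{W}S(\sigma(z_u,z_u),\sigma(z_u,z_v))$, $M=\frac{1}{W}S(\sigma(z_u,z_u),\sigma(z_v,z_v))$, $N=\frac{2}{W}S(\sigma(z_u,z_v),\sigma(z_v,z_v))$. A point is flat if $L=M=N=0$ there. A change of parameters is a smooth change $u=u(\bar u,\bar v)$, $v=v(\bar u,\bar v)$, $(\bar u,\bar v)\in\bar{\mathcal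 D}\subset\mathbb R^2$, with $u_{\bar u}v_{\bar v}-u_{\bar v}v_{\bar u}\neq0$; the vectors $X_1,X_2$ determining the tangents are kept fixed. A tangent $g$ at $p$ is a line through the origin of $T_pM^2$, determined by a nonzero vector $X=\lambda z_u+\mu z_v$. For such $g$ (with chosen vector $X$) define the linear map $\sigma_g:T_pM^2\to(T_pM^2)^\perp$, $\sigma_g(Y)=\sigma\left(\frac{\lambda z_u+\mu z_v}{\sqrt{I(\lambda,\mu)}},Y\right)$. For two tangents $g_1,g_2$ at $p$ define $$\zeta_{g_1,g_2}=\frac{S(\sigma_{g_1}(z_u),\sigma_{g_2}(z_v))}{W}+\frac{S(\sigma_{g_2}(z_u),\sigma_{g_1}(z_v))}{W}.$$ *)

theory Defs
  imports "HOL-Analysis.Analysis"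
begin

text \<open>Intended for open sets \<open>A\<close>: all derivatives are taken in the full neighbourhood filter.\<close>

fun Ck_on :: "nat \<Rightarrow> 'a::euclidean_space set \<Rightarrow> ('a \<Rightarrow> 'b::real_normed_vector) \<Rightarrow> bool" where
  "Ck_on 0 A f \<longleftrightarrow> continuous_on A f"
| "Ck_on (Suc k) A f \<longleftrightarrow>
     (\<forall>x\<in>A. f differentiable at x) \<and>
     (\<forall>b\<in>Basis. Ck_on k A (\<lambda>x. frechet_derivative f (at x) b))"

definition smooth_on :: "'a::euclidean_space set \<Rightarrow> ('a \<Rightarrow> 'b::real_normed_vector) \<Rightarrow> bool" where
  "smooth_on A f \<longleftrightarrow> (\<forall>k. Ck_on k A f)"

definition du :: "(real \<times> real \<Rightarrow> 'b::real_normed_vector) \<Rightarrow> real \<times> real \<Rightarrow> 'b" where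
  "du f q = frechet_derivative f (at q) (1, 0)"

definition dv :: "(real \<times> real \<Rightarrow> 'b::real_normed_vector) \<Rightarrow> real \<times> real \<Rightarrow> 'b" where
  "dv f q = frechet_derivative f (at q) (0, 1)"

definition tangent_space :: "(real \<times> real \<Rightarrow> real^4) \<Rightarrow> real \<times> real \<Rightarrow> (real^4) set" where
  "tangent_space z q = span {du z q, dv z q}"

definition normal_space :: "(real \<times> real \<Rightarrow> real^4) \<Rightarrow> real \<times> real \<Rightarrow> (real^4) set" where
  "normal_space z q = orthogonal_comp (tangent_space z q)"

definition regular_surface :: "(real \<times> real) set \<Rightarrow> (real \<times> real \<Rightarrow> real^4) \<Rightarrow> bool" where
  "regular_surface D z \<longleftrightarrow>
     open D \<and> smooth_on D z \<and> (\<forall>q\<in>D. dim (tangent_space z q) = 2)"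

definition change_of_parameters ::
  "(real \<times> real) set \<Rightarrow> (real \<times> real) set \<Rightarrow> (real \<times> real \<Rightarrow> real \<times> real) \<Rightarrow> bool" where
  "change_of_parameters D' D \<phi> \<longleftrightarrow>
     open D' \<and> smooth_on D' \<phi> \<and> \<phi> ` D' \<subseteq> D \<and>
     (\<forall>q\<in>D'. fst (du \<phi> q) * snd (dv \<phi> q) - fst (dv \<phi> q) * snd (du \<phi> q) \<noteq> 0)"

definition first_E :: "(real \<times> real \<Rightarrow> real^4) \<Rightarrow> real \<times> real \<Rightarrow> real" where
  "first_E z q = du z q \<bullet> du z q"

definition first_F :: "(real \<times> real \<Rightarrow> real^4) \<Rightarrow> real \<times> real \<Rightarrow> real" where
  "first_F z q = du z q \<bullet> dv z q"

definition first_G :: "(real \<times> real \<Rightarrow> real^4) \<Rightarrow> real \<times> real \<Rightarrow> real" where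
  "first_G z q = dv z q \<bullet> dv z q"

definition first_form :: "(real \<times> real \<Rightarrow> real^4) \<Rightarrow> real \<times> real \<Rightarrow> real \<times> real \<Rightarrow> real" where
  "first_form z q = (\<lambda>(l, m).
     first_E z q * l\<^sup>2 + 2 * first_F z q * l * m + first_G z q * m\<^sup>2)"

definition area_W :: "(real \<times> real \<Rightarrow> real^4) \<Rightarrow> real \<times> real \<Rightarrow> real" where
  "area_W z q = sqrt (first_E z q * first_G z q - (first_F z q)\<^sup>2)"

text \<open>Only the pointwise conditions on the frame are imposed; no continuity of
  \<open>e1\<close>, \<open>e2\<close> is assumed.\<close>

definition oriented_normal_frame ::
  "(real \<times> real) set \<Rightarrow> (real \<times> real \<Rightarrow> real^4) \<Rightarrow>
   (real \<times> real \<Rightarrow> real^4) \<Rightarrow> (real \<times> real \<Rightarrow> real^4) \<Rightarrow> bool" where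
  "oriented_normal_frame D z e1 e2 \<longleftrightarrow> (\<forall>q\<in>D.
     e1 q \<in> normal_space z q \<and> e2 q \<in> normal_space z q \<and>
     norm (e1 q) = 1 \<and> norm (e2 q) = 1 \<and> e1 q \<bullet> e2 q = 0 \<and>
     det (vector [du z q, dv z q, e1 q, e2 q] :: real^4^4) > 0)"

definition normal_part :: "(real \<times> real \<Rightarrow> real^4) \<Rightarrow> real \<times> real \<Rightarrow> real^4 \<Rightarrow> real^4" where
  "normal_part z q w = (THE n. n \<in> normal_space z q \<and> w - n \<in> tangent_space z q)"

definition tangent_coords :: "(real \<times> real \<Rightarrow> real^4) \<Rightarrow> real \<times> real \<Rightarrow> real^4 \<Rightarrow> real \<times> real" where
  "tangent_coords z q X = (THE (l, m). X = l *\<^sub>R du z q + m *\<^sub>R dv z q)"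

text \<open>\<open>sff z q X Y\<close> is meaningful for tangent vectors \<open>X\<close>, \<open>Y\<close> only; it is the bilinear
  extension of \<open>\<sigma>(z\<^sub>u, z\<^sub>u)\<close>, \<open>\<sigma>(z\<^sub>u, z\<^sub>v)\<close>, \<open>\<sigma>(z\<^sub>v, z\<^sub>v)\<close> = normal parts of \<open>z\<^sub>u\<^sub>u\<close>, \<open>z\<^sub>u\<^sub>v\<close>, \<open>z\<^sub>v\<^sub>v\<close>.\<close>

definition sff :: "(real \<times> real \<Rightarrow> real^4) \<Rightarrow> real \<times> real \<Rightarrow> real^4 \<Rightarrow> real^4 \<Rightarrow> real^4" where
  "sff z q X Y =
     (let (l, m) = tangent_coords z q X; (l', m') = tangent_coords z q Y in
        (l * l') *\<^sub>R normal_part z q (du (du z) q)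
      + (l * m' + m * l') *\<^sub>R normal_part z q (dv (du z) q)
      + (m * m') *\<^sub>R normal_part z q (dv (dv z) q))"

text \<open>The components of a normal vector in the orthonormal frame \<open>e1 q, e2 q\<close> are its inner
  products with the frame vectors.\<close>

definition area_S ::
  "(real \<times> real \<Rightarrow> real^4) \<Rightarrow> (real \<times> real \<Rightarrow> real^4) \<Rightarrow> real \<times> real \<Rightarrow> real^4 \<Rightarrow> real^4 \<Rightarrow> real" where
  "area_S e1 e2 q a b = (a \<bullet> e1 q) * (b \<bullet> e2 q) - (a \<bullet> e2 q) * (b \<bullet> e1 q)"

definition second_L ::
  "(real \<times> real \<Rightarrow> real^4) \<Rightarrow> (real \<times> real \<Rightarrow> real^4) \<Rightarrow> (real \<times> real \<Rightarrow> real^4) \<Rightarrow> real \<times> real \<Rightarrow> real" where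
  "second_L z e1 e2 q = 2 / area_W z q *
     area_S e1 e2 q (sff z q (du z q) (du z q)) (sff z q (du z q) (dv z q))"

definition second_M ::
  "(real \<times> real \<Rightarrow> real^4) \<Rightarrow> (real \<times> real \<Rightarrow> real^4) \<Rightarrow> (real \<times> real \<Rightarrow> real^4) \<Rightarrow> real \<times> real \<Rightarrow> real" where
  "second_M z e1 e2 q = 1 / area_W z q *
     area_S e1 e2 q (sff z q (du z q) (du z q)) (sff z q (dv z q) (dv z q))"

definition second_N ::
  "(real \<times> real \<Rightarrow> real^4) \<Rightarrow> (real \<times> real \<Rightarrow> real^4) \<Rightarrow> (real \<times> real \<Rightarrow> real^4) \<Rightarrow> real \<times> real \<Rightarrow> real" where
  "second_N z e1 e2 q = 2 / area_W z q *
     area_S e1 e2 q (sff z q (du z q) (dv z q)) (sff z q (dv z q) (dv z q))"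

definition flat_point ::
  "(real \<times> real \<Rightarrow> real^4) \<Rightarrow> (real \<times> real \<Rightarrow> real^4) \<Rightarrow> (real \<times> real \<Rightarrow> real^4) \<Rightarrow> real \<times> real \<Rightarrow> bool" where
  "flat_point z e1 e2 q \<longleftrightarrow>
     second_L z e1 e2 q = 0 \<and> second_M z e1 e2 q = 0 \<and> second_N z e1 e2 q = 0"

text \<open>The tangent \<open>g\<close> is represented by its chosen nonzero vector \<open>X\<close>.\<close>

definition sigma_g :: "(real \<times> real \<Rightarrow> real^4) \<Rightarrow> real \<times> real \<Rightarrow> real^4 \<Rightarrow> real^4 \<Rightarrow> real^4" where
  "sigma_g z q X Y = sff z q (X /\<^sub>R sqrt (first_form z q (tangent_coords z q X))) Y"

definition zeta ::
  "(real \<times> real \<Rightarrow> real^4) \<Rightarrow> (real \<times> real \<Rightarrow> real^4) \<Rightarrow> (real \<times> real \<Rightarrow> real^4) \<Rightarrow> real \<times> real \<Rightarrow>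
   real^4 \<Rightarrow> real^4 \<Rightarrow> real" where
  "zeta z e1 e2 q X1 X2 =
     area_S e1 e2 q (sigma_g z q X1 (du z q)) (sigma_g z q X2 (dv z q)) / area_W z q
   + area_S e1 e2 q (sigma_g z q X2 (du z q)) (sigma_g z q X1 (dv z q)) / area_W z q"

end

theory Submission
  imports Defs
begin

text \<open>Write \<open>q = \<phi> p\<close>, let \<open>J\<close> be the Jacobian determinant of the change of parameters at \<open>p\<close>, and mark
  the quantities of the new parametrization by a prime. The quantity \<open>\<zeta>\<close> is built from three things.

  The maps \<open>\<sigma>\<^sub>g\<close> do not depend on the parameters. Both parametrizations have the same tangent plane,
  hence the same normal projection, and the second-order chain rule expresses the second derivatives
  of \<open>z \<circ> \<phi>\<close> by those of \<open>z\<close> up to tangent vectors. This makes the second fundamental tensor \<open>\<sigma>\<close> a bilinear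
  map on the tangent plane itself (\<open>sff_reparam\<close>). It requires the symmetry of the mixed derivatives of
  \<open>z\<close> (\<open>dv_du_eq_du_dv\<close>), because the definition of \<open>\<sigma>\<close> contains only one of the two. The normalization in
  \<open>\<sigma>\<^sub>g\<close> divides by the Euclidean length of the vector that represents \<open>g\<close>.

  The area of normal vectors is \<open>S(x, y) = det (z\<^sub>u, z\<^sub>v, x, y) / W\<close> whatever the positively oriented normal
  frame (\<open>area_W_mult_area_S_eq_det\<close>). Replacing \<open>z\<^sub>u, z\<^sub>v\<close> by the new coordinate vectors multiplies the
  determinant by \<open>J\<close>, so \<open>S' = (J W / W') S\<close> (\<open>area_S_reparam\<close>).

  Finally \<open>(Y, Z) \<mapsto> S(\<sigma>\<^sub>1 Y, \<sigma>\<^sub>2 Z) + S(\<sigma>\<^sub>2 Y, \<sigma>\<^sub>1 Z)\<close>, where \<open>\<sigma>\<^sub>i\<close> is \<open>\<sigma>\<^sub>g\<close> for the tangent \<open>g\<^sub>i\<close>, is an alternating bilinear form on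
  the tangent plane, so passing from \<open>(z\<^sub>u, z\<^sub>v)\<close> to the new coordinate vectors multiplies it by \<open>J\<close> as well.
  Altogether \<open>\<zeta>' = (J\<^sup>2 W\<^sup>2 / W'\<^sup>2) \<zeta>\<close>, and \<open>W'\<^sup>2 = J\<^sup>2 W\<^sup>2\<close>.\<close>

section \<open>Determinants and Gram matrices\<close>

lemma det_4:
  "det (A::'a::comm_ring_1^4^4) =
     A$1$1 * A$2$2 * A$3$3 * A$4$4 - A$1$1 * A$2$2 * A$3$4 * A$4$3
   - A$1$1 * A$2$3 * A$3$2 * A$4$4 + A$1$1 * A$2$3 * A$3$4 * A$4$2
   + A$1$1 * A$2$4 * A$3$2 * A$4$3 - A$1$1 * A$2$4 * A$3$3 * A$4$2
   - A$1$2 * A$2$1 * A$3$3 * A$4$4 + A$1$2 * A$2$1 * A$3$4 * A$4$3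
   + A$1$2 * A$2$3 * A$3$1 * A$4$4 - A$1$2 * A$2$3 * A$3$4 * A$4$1
   - A$1$2 * A$2$4 * A$3$1 * A$4$3 + A$1$2 * A$2$4 * A$3$3 * A$4$1
   + A$1$3 * A$2$1 * A$3$2 * A$4$4 - A$1$3 * A$2$1 * A$3$4 * A$4$2
   - A$1$3 * A$2$2 * A$3$1 * A$4$4 + A$1$3 * A$2$2 * A$3$4 * A$4$1
   + A$1$3 * A$2$4 * A$3$1 * A$4$2 - A$1$3 * A$2$4 * A$3$2 * A$4$1
   - A$1$4 * A$2$1 * A$3$2 * A$4$3 + A$1$4 * A$2$1 * A$3$3 * A$4$2
   + A$1$4 * A$2$2 * A$3$1 * A$4$3 - A$1$4 * A$2$2 * A$3$3 * A$4$1
   - A$1$4 * A$2$3 * A$3$1 * A$4$2 + A$1$4 * A$2$3 * A$3$2 * A$4$1"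
proof -
  have f1234: "finite {2::4, 3, 4}" "1 \<notin> {2::4, 3, 4}" and f234: "finite {3::4, 4}" "2 \<notin> {3::4, 4}"
    and f34: "finite {4::4}" "3 \<notin> {4::4}" by auto
  show ?thesis
    unfolding det_def UNIV_4
    unfolding sum_over_permutations_insert[OF f1234]
    unfolding sum_over_permutations_insert[OF f234]
    unfolding sum_over_permutations_insert[OF f34]
    unfolding permutes_sing
    by (simp add: sign_swap_id permutation_swap_id sign_compose sign_id permutation_compose
        transpose_def algebra_simps)
qed

lemma vector_4 [simp]:
  "(vector [w,x,y,z] :: 'a::zero^4)$1 = w"
  "(vector [w,x,y,z] :: 'a::zero^4)$2 = x"
  "(vector [w,x,y,z] :: 'a::zero^4)$3 = y"
  "(vector [w,x,y,z] :: 'a::zero^4)$4 = z"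
  unfolding vector_def by simp_all

lemma det_rows_change_basis:
  fixes a b x y :: "real^4"
  shows "det (vector [\<alpha> *\<^sub>R a + \<gamma> *\<^sub>R b, \<beta> *\<^sub>R a + \<delta> *\<^sub>R b, x, y] :: real^4^4) =
     (\<alpha> * \<delta> - \<beta> * \<gamma>) * det (vector [a, b, x, y] :: real^4^4)"
  by (simp add: det_4 algebra_simps)

text \<open>The product of the first matrix with the transpose of the second consists of the inner products
  of their rows. The orthogonality assumptions make it block diagonal, with the Gram matrix of
  \<open>a\<close>, \<open>b\<close> as one block and the inner products of \<open>x\<close>, \<open>y\<close> with \<open>e\<close>, \<open>f\<close> as the other.\<close>

lemma det_mult_det_eq_gram:
  fixes a b x y e f :: "real^4"
  assumes "a \<bullet> e = 0" "a \<bullet> f = 0" "b \<bullet> e = 0" "b \<bullet> f = 0"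
    and "x \<bullet> a = 0" "x \<bullet> b = 0" "y \<bullet> a = 0" "y \<bullet> b = 0"
  shows "det (vector [a, b, x, y] :: real^4^4) * det (vector [a, b, e, f] :: real^4^4) =
     ((a \<bullet> a) * (b \<bullet> b) - (a \<bullet> b)\<^sup>2) * ((x \<bullet> e) * (y \<bullet> f) - (x \<bullet> f) * (y \<bullet> e))"
proof -
  let ?A = "vector [a, b, x, y] :: real^4^4" and ?B = "vector [a, b, e, f] :: real^4^4"
  have entry: "(?A ** transpose ?B) $ i $ j = ?A $ i \<bullet> ?B $ j" for i j
    by (simp add: matrix_matrix_mult_def transpose_def inner_vec_def)
  have "det ?A * det ?B = det (?A ** transpose ?B)"
    by (simp add: det_mul)
  also have "\<dots> = ((a \<bullet> a) * (b \<bullet> b) - (a \<bullet> b)\<^sup>2) * ((x \<bullet> e) * (y \<bullet> f) - (x \<bullet> f) * (y \<bullet> e))"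
    using assms by (simp add: det_4 entry inner_commute[of b a] power2_eq_square algebra_simps)
  finally show ?thesis .
qed

section \<open>Symmetry of mixed partial derivatives\<close>

text \<open>Two applications of the mean value theorem, first in \<open>s\<close> to the difference
  \<open>f s (y + h) - f s y\<close>, then in \<open>t\<close> to \<open>fu s t\<close>. The second difference on the left is symmetric in the
  two variables, so the same argument with the roles exchanged makes it a value of the other mixed derivative.\<close>

lemma second_difference_eq_mixed_partial:
  fixes f fu fuv :: "real \<Rightarrow> real \<Rightarrow> real"
  assumes "0 < h"
    and fu: "\<And>s t. \<lbrakk>x \<le> s; s \<le> x + h; y \<le> t; t \<le> y + h\<rbrakk>
       \<Longrightarrow> ((\<lambda>s. f s t) has_real_derivative fu s t) (at s)"
    and fuv: "\<And>s t. \<lbrakk>x \<le> s; s \<le> x + h; y \<le> t; t \<le> y + h\<rbrakk>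
       \<Longrightarrow> (fu s has_real_derivative fuv s t) (at t)"
  obtains s t where "x \<le> s" "s \<le> x + h" "y \<le> t" "t \<le> y + h"
    "f (x + h) (y + h) - f (x + h) y - f x (y + h) + f x y = h * h * fuv s t"
proof -
  let ?g = "\<lambda>s. f s (y + h) - f s y"
  have "\<exists>s>x. s < x + h \<and> ?g (x + h) - ?g x = (x + h - x) * (fu s (y + h) - fu s y)"
    using \<open>0 < h\<close> by (intro MVT2) (auto intro!: DERIV_diff fu)
  then obtain s where s: "x < s" "s < x + h"
    and eq1: "?g (x + h) - ?g x = h * (fu s (y + h) - fu s y)"
    by auto
  have "\<exists>t>y. t < y + h \<and> fu s (y + h) - fu s y = (y + h - y) * fuv s t"
    using \<open>0 < h\<close> s by (intro MVT2) (auto intro!: fuv)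
  then obtain t where t: "y < t" "t < y + h" and eq2: "fu s (y + h) - fu s y = h * fuv s t"
    by auto
  show thesis
    using s t eq1 eq2 by (intro that[of s t]) (auto simp: algebra_simps)
qed

text \<open>If the two mixed derivatives differed at the centre, continuity would keep their values
  on a small square apart; but each of them takes the value of the second difference, divided by
  the area, somewhere in that square.\<close>

lemma mixed_partials_commute_real:
  fixes f fu fv fuv fvu :: "real \<Rightarrow> real \<Rightarrow> real"
  assumes "0 < r"
    and fu: "\<And>s t. (s, t) \<in> ball (x, y) r \<Longrightarrow> ((\<lambda>s. f s t) has_real_derivative fu s t) (at s)"
    and fv: "\<And>s t. (s, t) \<in> ball (x, y) r \<Longrightarrow> (f s has_real_derivative fv s t) (at t)"
    and fuv: "\<And>s t. (s, t) \<in> ball (x, y) r \<Longrightarrow> (fu s has_real_derivative fuv s t) (at t)"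
    and fvu: "\<And>s t. (s, t) \<in> ball (x, y) r \<Longrightarrow> ((\<lambda>s. fv s t) has_real_derivative fvu s t) (at s)"
    and cont: "isCont (\<lambda>(s, t). fuv s t) (x, y)" "isCont (\<lambda>(s, t). fvu s t) (x, y)"
  shows "fuv x y = fvu x y"
proof (rule ccontr)
  assume neq: "fuv x y \<noteq> fvu x y"
  define e where "e = \<bar>fuv x y - fvu x y\<bar> / 2"
  have "0 < e" using neq by (simp add: e_def)
  obtain d1 where "0 < d1"
    and d1: "\<And>p. dist p (x, y) < d1 \<Longrightarrow> dist (case p of (s, t) \<Rightarrow> fuv s t) (fuv x y) < e"
    using cont(1) \<open>0 < e\<close> unfolding continuous_at_eps_delta by fastforce
  obtain d2 where "0 < d2"
    and d2: "\<And>p. dist p (x, y) < d2 \<Longrightarrow> dist (case p of (s, t) \<Rightarrow> fvu s t) (fvu x y) < e"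
    using cont(2) \<open>0 < e\<close> unfolding continuous_at_eps_delta by fastforce
  \<comment> \<open>Points of the square of side \<open>h\<close> are at distance at most \<open>2 * h\<close> from its corner \<open>(x, y)\<close>.\<close>
  define h where "h = min r (min d1 d2) / 3"
  have h: "0 < h" "2 * h < r" "2 * h < d1" "2 * h < d2"
    using \<open>0 < r\<close> \<open>0 < d1\<close> \<open>0 < d2\<close> by (auto simp: h_def)
  have close: "dist (s, t) (x, y) \<le> 2 * h"
    if "x \<le> s" "s \<le> x + h" "y \<le> t" "t \<le> y + h" for s t
  proof -
    have "dist (s, t) (x, y) \<le> dist s x + dist t y"
      unfolding dist_Pair_Pair by (rule sqrt_sum_squares_le_sum) auto
    also have "\<dots> \<le> 2 * h" using that by (simp add: dist_real_def)
    finally show ?thesis .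
  qed
  have in_ball: "(s, t) \<in> ball (x, y) r" if "x \<le> s" "s \<le> x + h" "y \<le> t" "t \<le> y + h" for s t
    using close[OF that] h by (simp add: dist_commute)
  obtain s t where st: "x \<le> s" "s \<le> x + h" "y \<le> t" "t \<le> y + h"
    and eq1: "f (x + h) (y + h) - f (x + h) y - f x (y + h) + f x y = h * h * fuv s t"
    using second_difference_eq_mixed_partial[OF h(1), of x y f fu fuv] fu fuv in_ball by blast
  obtain t' s' where st': "y \<le> t'" "t' \<le> y + h" "x \<le> s'" "s' \<le> x + h"
    and eq2: "f (x + h) (y + h) - f x (y + h) - f (x + h) y + f x y = h * h * fvu s' t'"
    using second_difference_eq_mixed_partial[OF h(1), of y x "\<lambda>t s. f s t" "\<lambda>t s. fv s t" "\<lambda>t s. fvu s t"]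
      fv fvu in_ball by blast
  have "h * h * fuv s t = h * h * fvu s' t'"
    using eq1 eq2 by linarith
  then have eq: "fuv s t = fvu s' t'"
    using h(1) by simp
  have "dist (fuv s t) (fuv x y) < e" "dist (fvu s' t') (fvu x y) < e"
    using d1[of "(s, t)"] d2[of "(s', t')"] close[OF st] close[OF st'(3,4,1,2)] h by auto
  then show False
    using eq by (simp add: e_def dist_real_def abs_if split: if_splits)
qed

section \<open>First and second derivatives in two variables\<close>

lemma Basis_real_pair: "(1, 0) \<in> (Basis :: (real \<times> real) set)" "(0, 1) \<in> (Basis :: (real \<times> real) set)"
  by (auto simp: Basis_prod_def)

lemma smooth_on_differentiable: "smooth_on A f \<Longrightarrow> x \<in> A \<Longrightarrow> f differentiable (at x)"
  unfolding smooth_on_def by (metis Ck_on.simps(2))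

lemma smooth_on_continuous_on: "smooth_on A f \<Longrightarrow> continuous_on A f"
  unfolding smooth_on_def by (metis Ck_on.simps(1))

lemma smooth_on_frechet_derivative:
  "smooth_on A f \<Longrightarrow> b \<in> Basis \<Longrightarrow> smooth_on A (\<lambda>x. frechet_derivative f (at x) b)"
  unfolding smooth_on_def by (metis Ck_on.simps(2))

lemma smooth_on_du: "smooth_on A f \<Longrightarrow> smooth_on A (du f)"
  and smooth_on_dv: "smooth_on A f \<Longrightarrow> smooth_on A (dv f)"
  using smooth_on_frechet_derivative[of A f] Basis_real_pair unfolding du_def[abs_def] dv_def[abs_def] by auto

lemma frechet_derivative_eq_du_dv:
  assumes "f differentiable (at q)"
  shows "frechet_derivative f (at q) w = fst w *\<^sub>R du f q + snd w *\<^sub>R dv f q"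
proof -
  interpret linear "frechet_derivative f (at q)"
    by (rule linear_frechet_derivative[OF assms])
  have "w = fst w *\<^sub>R (1, 0) + snd w *\<^sub>R (0, 1)"
    by (simp add: prod_eq_iff)
  then have "frechet_derivative f (at q) w = frechet_derivative f (at q) (fst w *\<^sub>R (1, 0) + snd w *\<^sub>R (0, 1))"
    by simp
  then show ?thesis
    by (simp add: add scaleR du_def dv_def del: scaleR_Pair)
qed

lemma has_derivative_du_dv:
  assumes "f differentiable (at q)"
  shows "(f has_derivative (\<lambda>w. fst w *\<^sub>R du f q + snd w *\<^sub>R dv f q)) (at q)"
  using assms frechet_derivative_eq_du_dv[OF assms] unfolding frechet_derivative_works
  by (metis (no_types, lifting) ext)

lemma has_real_derivative_inner_du:
  fixes f :: "real \<times> real \<Rightarrow> 'b::real_inner"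
  assumes "f differentiable (at (s, t))"
  shows "((\<lambda>s. f (s, t) \<bullet> c) has_real_derivative du f (s, t) \<bullet> c) (at s)"
proof -
  have "((\<lambda>s. (s, t)) has_derivative (\<lambda>h. (h, 0))) (at s)"
    by (auto intro!: derivative_eq_intros)
  from has_derivative_compose[OF this has_derivative_du_dv[OF assms]]
  have "((\<lambda>s. f (s, t)) has_derivative (\<lambda>h. h *\<^sub>R du f (s, t))) (at s)"
    by simp
  then have "((\<lambda>s. f (s, t) \<bullet> c) has_derivative (\<lambda>h. h *\<^sub>R du f (s, t) \<bullet> c)) (at s)"
    by (rule has_derivative_inner_left)
  then show ?thesis
    by (simp add: has_field_derivative_def mult_commute_abs)
qed

lemma has_real_derivative_inner_dv:
  fixes f :: "real \<times> real \<Rightarrow> 'b::real_inner"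
  assumes "f differentiable (at (s, t))"
  shows "((\<lambda>t. f (s, t) \<bullet> c) has_real_derivative dv f (s, t) \<bullet> c) (at t)"
proof -
  have "((\<lambda>t. (s, t)) has_derivative (\<lambda>h. (0, h))) (at t)"
    by (auto intro!: derivative_eq_intros)
  from has_derivative_compose[OF this has_derivative_du_dv[OF assms]]
  have "((\<lambda>t. f (s, t)) has_derivative (\<lambda>h. h *\<^sub>R dv f (s, t))) (at t)"
    by simp
  then have "((\<lambda>t. f (s, t) \<bullet> c) has_derivative (\<lambda>h. h *\<^sub>R dv f (s, t) \<bullet> c)) (at t)"
    by (rule has_derivative_inner_left)
  then show ?thesis
    by (simp add: has_field_derivative_def mult_commute_abs)
qed

text \<open>Inner products with a fixed vector reduce the claim to real functions.\<close>

lemma dv_du_eq_du_dv: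
  fixes f :: "real \<times> real \<Rightarrow> 'b::real_inner"
  assumes "open D" "smooth_on D f" "q \<in> D"
  shows "dv (du f) q = du (dv f) q"
proof -
  obtain r where "0 < r" and r: "ball q r \<subseteq> D"
    using assms(1,3) open_contains_ball by blast
  obtain x y where q: "q = (x, y)" by (cases q)
  have diff: "f differentiable (at p)" "du f differentiable (at p)" "dv f differentiable (at p)"
    if "p \<in> ball (x, y) r" for p
    using that r q assms(2) smooth_on_differentiable smooth_on_du smooth_on_dv by blast+
  have cont: "isCont (dv (du f)) q" "isCont (du (dv f)) q"
    using assms smooth_on_continuous_on smooth_on_du smooth_on_dv continuous_on_eq_continuous_at
    by blast+
  have "dv (du f) q \<bullet> c = du (dv f) q \<bullet> c" for c
    unfolding q
  proof (rule mixed_partials_commute_real[OF \<open>0 < r\<close>, where f = "\<lambda>s t. f (s, t) \<bullet> c"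
        and fu = "\<lambda>s t. du f (s, t) \<bullet> c" and fuv = "\<lambda>s t. dv (du f) (s, t) \<bullet> c"
        and fv = "\<lambda>s t. dv f (s, t) \<bullet> c" and fvu = "\<lambda>s t. du (dv f) (s, t) \<bullet> c"])
    show "isCont (\<lambda>(s, t). dv (du f) (s, t) \<bullet> c) (x, y)" "isCont (\<lambda>(s, t). du (dv f) (s, t) \<bullet> c) (x, y)"
      using cont unfolding q by (auto simp: split_def intro!: continuous_intros)
  qed (auto intro!: has_real_derivative_inner_du has_real_derivative_inner_dv diff simp del: mem_ball)
  then show ?thesis
    by (metis vector_eq_rdot)
qed

lemma frechet_derivative_compose_du_dv:
  assumes "\<phi> differentiable (at p)" "f differentiable (at (\<phi> p))"
  shows "frechet_derivative (f \<circ> \<phi>) (at p) w =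
     fst (frechet_derivative \<phi> (at p) w) *\<^sub>R du f (\<phi> p) + snd (frechet_derivative \<phi> (at p) w) *\<^sub>R dv f (\<phi> p)"
  using assms by (simp add: frechet_derivative_compose frechet_derivative_eq_du_dv[OF assms(2)])

text \<open>The product rule applied to the first-order chain rule. The coefficients \<open>c\<close>, \<open>d\<close> are second
  derivatives of \<open>\<phi>\<close>; they stay unspecified because they multiply first derivatives of \<open>f\<close>, which are
  tangent vectors when \<open>f\<close> is a surface and disappear under the normal projection. The mixed terms
  are collected by the symmetry of the mixed derivatives of \<open>f\<close>.\<close>

lemma second_derivative_compose:
  fixes f :: "real \<times> real \<Rightarrow> 'b::real_inner" and \<phi> :: "real \<times> real \<Rightarrow> real \<times> real"
  assumes D: "open D" "smooth_on D f" and D': "open D'" "smooth_on D' \<phi>" "\<phi> ` D' \<subseteq> D"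
    and p: "p \<in> D'" and e: "e \<in> Basis"
    and A: "A = frechet_derivative \<phi> (at p) e" and B: "B = frechet_derivative \<phi> (at p) e'"
  obtains c d where
    "frechet_derivative (\<lambda>x. frechet_derivative (f \<circ> \<phi>) (at x) e) (at p) e' =
       (fst A * fst B) *\<^sub>R du (du f) (\<phi> p)
     + (fst A * snd B + snd A * fst B) *\<^sub>R dv (du f) (\<phi> p)
     + (snd A * snd B) *\<^sub>R dv (dv f) (\<phi> p)
     + c *\<^sub>R du f (\<phi> p) + d *\<^sub>R dv f (\<phi> p)"
proof -
  let ?\<psi> = "\<lambda>x. frechet_derivative \<phi> (at x) e"
  let ?C = "frechet_derivative ?\<psi> (at p) e'"
  have in_D: "\<phi> x \<in> D" if "x \<in> D'" for x
    using that D' by auto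
  note diff_\<phi> = smooth_on_differentiable[OF D'(2)]
  note diff_f = smooth_on_differentiable[OF D(2) in_D]
  note diff_fu = smooth_on_differentiable[OF smooth_on_du[OF D(2)] in_D]
  note diff_fv = smooth_on_differentiable[OF smooth_on_dv[OF D(2)] in_D]
  have "?\<psi> differentiable (at p)"
    using smooth_on_differentiable[OF smooth_on_frechet_derivative[OF D'(2) e] p] .
  then have \<psi>: "(?\<psi> has_derivative frechet_derivative ?\<psi> (at p)) (at p)"
    by (simp add: frechet_derivative_works)
  have fu: "((\<lambda>x. du f (\<phi> x)) has_derivative frechet_derivative (du f \<circ> \<phi>) (at p)) (at p)"
    and fv: "((\<lambda>x. dv f (\<phi> x)) has_derivative frechet_derivative (dv f \<circ> \<phi>) (at p)) (at p)"
    using differentiable_chain_at[OF diff_\<phi>[OF p]] diff_fu[OF p] diff_fv[OF p]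
    unfolding frechet_derivative_works o_def by blast+
  have first: "fst (?\<psi> x) *\<^sub>R du f (\<phi> x) + snd (?\<psi> x) *\<^sub>R dv f (\<phi> x) = frechet_derivative (f \<circ> \<phi>) (at x) e"
    if "x \<in> D'" for x
    using frechet_derivative_compose_du_dv[OF diff_\<phi>[OF that] diff_f[OF that]] by simp
  have "((\<lambda>x. fst (?\<psi> x) *\<^sub>R du f (\<phi> x) + snd (?\<psi> x) *\<^sub>R dv f (\<phi> x)) has_derivative
     (\<lambda>h. (fst (?\<psi> p) *\<^sub>R frechet_derivative (du f \<circ> \<phi>) (at p) h
           + fst (frechet_derivative ?\<psi> (at p) h) *\<^sub>R du f (\<phi> p))
        + (snd (?\<psi> p) *\<^sub>R frechet_derivative (dv f \<circ> \<phi>) (at p) h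
           + snd (frechet_derivative ?\<psi> (at p) h) *\<^sub>R dv f (\<phi> p)))) (at p)"
    by (intro has_derivative_add has_derivative_scaleR has_derivative_fst has_derivative_snd \<psi> fu fv)
  from has_derivative_transform_within_open[OF this D'(1) p first]
  have "frechet_derivative (\<lambda>x. frechet_derivative (f \<circ> \<phi>) (at x) e) (at p) e' =
      (fst A *\<^sub>R frechet_derivative (du f \<circ> \<phi>) (at p) e' + fst ?C *\<^sub>R du f (\<phi> p))
    + (snd A *\<^sub>R frechet_derivative (dv f \<circ> \<phi>) (at p) e' + snd ?C *\<^sub>R dv f (\<phi> p))"
    unfolding A by (simp add: frechet_derivative_at[symmetric])
  also have "frechet_derivative (du f \<circ> \<phi>) (at p) e' = fst B *\<^sub>R du (du f) (\<phi> p) + snd B *\<^sub>R dv (du f) (\<phi> p)"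
    unfolding B by (rule frechet_derivative_compose_du_dv[OF diff_\<phi>[OF p] diff_fu[OF p]])
  also have "frechet_derivative (dv f \<circ> \<phi>) (at p) e' = fst B *\<^sub>R dv (du f) (\<phi> p) + snd B *\<^sub>R dv (dv f) (\<phi> p)"
    unfolding B dv_du_eq_du_dv[OF D in_D[OF p]]
    by (rule frechet_derivative_compose_du_dv[OF diff_\<phi>[OF p] diff_fv[OF p]])
  finally show thesis
    by (intro that[of "fst ?C" "snd ?C"]) (simp add: algebra_simps o_def)
qed

section \<open>Normal part and second fundamental tensor at a point\<close>

lemma mem_tangent_space: "X \<in> tangent_space z q \<longleftrightarrow> (\<exists>l m. X = l *\<^sub>R du z q + m *\<^sub>R dv z q)"
  unfolding tangent_space_def span_insert span_empty
  by (simp add: algebra_simps)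

lemma mem_normal_space: "n \<in> normal_space z q \<longleftrightarrow> n \<bullet> du z q = 0 \<and> n \<bullet> dv z q = 0"
proof
  assume "n \<in> normal_space z q"
  then show "n \<bullet> du z q = 0 \<and> n \<bullet> dv z q = 0"
    by (auto simp: normal_space_def orthogonal_comp_def orthogonal_def tangent_space_def inner_commute span_base)
next
  assume "n \<bullet> du z q = 0 \<and> n \<bullet> dv z q = 0"
  then show "n \<in> normal_space z q"
    by (auto simp: normal_space_def orthogonal_comp_def orthogonal_def mem_tangent_space inner_add_left
        inner_commute[of _ n] inner_simps)
qed

lemma subspace_normal_space: "subspace (normal_space z q)"
  unfolding normal_space_def by (rule subspace_orthogonal_comp)

lemma subspace_tangent_space: "subspace (tangent_space z q)"
  unfolding tangent_space_def by (rule subspace_span)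

lemma normal_partI:
  assumes "n \<in> normal_space z q" "w - n \<in> tangent_space z q"
  shows "normal_part z q w = n"
  unfolding normal_part_def
proof (rule the_equality)
  fix n' assume n': "n' \<in> normal_space z q \<and> w - n' \<in> tangent_space z q"
  have "(w - n') - (w - n) \<in> tangent_space z q" "n - n' \<in> normal_space z q"
    using n' assms subspace_diff subspace_tangent_space subspace_normal_space by blast+
  then have "orthogonal (n - n') (n - n')"
    by (simp add: normal_space_def orthogonal_comp_def)
  then show "n' = n"
    by (simp add: orthogonal_def)
qed (use assms in simp)

lemma normal_part:
  shows normal_part_in_normal_space: "normal_part z q w \<in> normal_space z q"
    and minus_normal_part_in_tangent_space: "w - normal_part z q w \<in> tangent_space z q"
proof -
  obtain t n where tn: "t \<in> tangent_space z q" "\<And>x. x \<in> tangent_space z q \<Longrightarrow> orthogonal n x" "w = t + n"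
    using orthogonal_subspace_decomp_exists[of "{du z q, dv z q}" w] unfolding tangent_space_def by blast
  then have "n \<in> normal_space z q"
    by (simp add: normal_space_def orthogonal_comp_def orthogonal_commute)
  moreover have "w - n \<in> tangent_space z q"
    using tn by simp
  ultimately show "normal_part z q w \<in> normal_space z q" "w - normal_part z q w \<in> tangent_space z q"
    using normal_partI by metis+
qed

lemma linear_normal_part: "linear (normal_part z q)"
proof
  fix v w r
  have "(v + w) - (normal_part z q v + normal_part z q w)
      = (v - normal_part z q v) + (w - normal_part z q w)" by simp
  also have "\<dots> \<in> tangent_space z q"
    by (intro subspace_add subspace_tangent_space minus_normal_part_in_tangent_space)
  finally show "normal_part z q (v + w) = normal_part z q v + normal_part z q w"
    by (intro normal_partI subspace_add subspace_normal_space normal_part_in_normal_space)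
  have "r *\<^sub>R w - r *\<^sub>R normal_part z q w = r *\<^sub>R (w - normal_part z q w)"
    by (simp add: algebra_simps)
  also have "\<dots> \<in> tangent_space z q"
    by (intro subspace_scale subspace_tangent_space minus_normal_part_in_tangent_space)
  finally show "normal_part z q (r *\<^sub>R w) = r *\<^sub>R normal_part z q w"
    by (intro normal_partI subspace_scale subspace_normal_space normal_part_in_normal_space)
qed

lemma normal_part_tangent: "t \<in> tangent_space z q \<Longrightarrow> normal_part z q t = 0"
  by (intro normal_partI) (auto simp: subspace_0 subspace_normal_space)

lemma normal_part_cong:
  "tangent_space z' q' = tangent_space z q \<Longrightarrow> normal_part z' q' = normal_part z q"
  by (simp add: normal_part_def normal_space_def fun_eq_iff)

text \<open>A nonzero area of the coordinate parallelogram makes the linear system for the coordinates,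
  obtained from inner products with \<open>z\<^sub>u\<close> and \<open>z\<^sub>v\<close>, uniquely solvable.\<close>

lemma tangent_coords_eq:
  assumes "area_W z q \<noteq> 0"
  shows "tangent_coords z q (l *\<^sub>R du z q + m *\<^sub>R dv z q) = (l, m)"
  unfolding tangent_coords_def
proof (rule the_equality)
  fix c :: "real \<times> real"
  obtain l' m' where c: "c = (l', m')" by (cases c)
  assume "case c of (l', m') \<Rightarrow> l *\<^sub>R du z q + m *\<^sub>R dv z q = l' *\<^sub>R du z q + m' *\<^sub>R dv z q"
  then have *: "(l - l') *\<^sub>R du z q + (m - m') *\<^sub>R dv z q = 0"
    by (simp add: c algebra_simps)
  have eqs: "(l - l') * first_E z q + (m - m') * first_F z q = 0"
    "(l - l') * first_F z q + (m - m') * first_G z q = 0"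
    using arg_cong[OF *, of "\<lambda>x. x \<bullet> du z q"] arg_cong[OF *, of "\<lambda>x. x \<bullet> dv z q"]
    by (simp_all add: inner_simps first_E_def first_F_def first_G_def inner_commute)
  have "(l - l') * (first_E z q * first_G z q - (first_F z q)\<^sup>2) = 0"
    "(m - m') * (first_E z q * first_G z q - (first_F z q)\<^sup>2) = 0"
    using eqs by algebra+
  then show "c = (l, m)"
    using assms by (auto simp: c area_W_def)
qed simp

lemma first_form_tangent_coords:
  assumes "area_W z q \<noteq> 0" "X \<in> tangent_space z q"
  shows "first_form z q (tangent_coords z q X) = X \<bullet> X"
  using assms(2) unfolding mem_tangent_space
  by (auto simp: tangent_coords_eq[OF assms(1)] first_form_def first_E_def first_F_def first_G_def
      inner_simps inner_commute power2_eq_square algebra_simps)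

lemma sff_eq:
  assumes "area_W z q \<noteq> 0"
  shows "sff z q (l *\<^sub>R du z q + m *\<^sub>R dv z q) (l' *\<^sub>R du z q + m' *\<^sub>R dv z q) =
     normal_part z q ((l * l') *\<^sub>R du (du z) q + (l * m' + m * l') *\<^sub>R dv (du z) q + (m * m') *\<^sub>R dv (dv z) q)"
proof -
  interpret linear "normal_part z q" by (rule linear_normal_part)
  show ?thesis
    by (simp add: sff_def tangent_coords_eq[OF assms] add scaleR)
qed

lemma sff_in_normal_space: "sff z q X Y \<in> normal_space z q"
  by (auto simp: sff_def split_def Let_def
      intro!: subspace_add subspace_scale subspace_normal_space normal_part_in_normal_space)

lemma sff_add_scale_right:
  assumes W: "area_W z q \<noteq> 0" and "X \<in> tangent_space z q"
  shows "sff z q X (l *\<^sub>R du z q + m *\<^sub>R dv z q) = l *\<^sub>R sff z q X (du z q) + m *\<^sub>R sff z q X (dv z q)"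
  using assms(2) tangent_coords_eq[OF W, of 1 0] tangent_coords_eq[OF W, of 0 1] unfolding mem_tangent_space
  by (auto simp: sff_def tangent_coords_eq[OF W] algebra_simps)

text \<open>The first fundamental form of the coordinates of \<open>X\<close> is \<open>X \<bullet> X\<close>, so the normalization divides by the
  Euclidean length of \<open>X\<close>, in which the parameters do not occur.\<close>

lemma sigma_g_eq:
  assumes "area_W z q \<noteq> 0" "X \<in> tangent_space z q"
  shows "sigma_g z q X = sff z q (X /\<^sub>R norm X)"
  by (simp add: sigma_g_def fun_eq_iff first_form_tangent_coords[OF assms] norm_eq_sqrt_inner)

text \<open>The area of a pair of normal vectors has a description in which the normal frame does not
  occur. By the Gram identity the determinant \<open>d\<close> of \<open>z\<^sub>u, z\<^sub>v, e\<^sub>1, e\<^sub>2\<close> satisfies \<open>d\<^sup>2 = E G - F\<^sup>2\<close>, and the positive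
  orientation selects the root \<open>d = W\<close>. The same identity for \<open>x, y\<close> against \<open>e\<^sub>1, e\<^sub>2\<close> then gives the claim
  after division by \<open>d\<close>.\<close>

lemma
  assumes frame: "oriented_normal_frame D z e1 e2" and q: "q \<in> D"
  shows area_W_pos: "0 < area_W z q"
    and area_W_mult_area_S_eq_det: "x \<in> normal_space z q \<Longrightarrow> y \<in> normal_space z q \<Longrightarrow>
      area_W z q * area_S e1 e2 q x y = det (vector [du z q, dv z q, x, y] :: real^4^4)"
proof -
  let ?d = "det (vector [du z q, dv z q, e1 q, e2 q] :: real^4^4)"
  let ?g = "first_E z q * first_G z q - (first_F z q)\<^sup>2"
  have e: "e1 q \<bullet> du z q = 0" "e1 q \<bullet> dv z q = 0" "e2 q \<bullet> du z q = 0" "e2 q \<bullet> dv z q = 0"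
    "e1 q \<bullet> e1 q = 1" "e2 q \<bullet> e2 q = 1" "e1 q \<bullet> e2 q = 0" and pos: "0 < ?d"
    using frame q unfolding oriented_normal_frame_def mem_normal_space by (auto simp: norm_eq_1)
  have gram: "det (vector [du z q, dv z q, x, y] :: real^4^4) * ?d = ?g * area_S e1 e2 q x y"
    if "x \<in> normal_space z q" "y \<in> normal_space z q" for x y
    using that e unfolding mem_normal_space first_E_def first_F_def first_G_def area_S_def
    by (intro det_mult_det_eq_gram) (auto simp: inner_commute)
  have g: "?g = ?d * ?d"
    using gram[of "e1 q" "e2 q"] frame q e
    by (simp add: oriented_normal_frame_def area_S_def inner_commute)
  then have W: "area_W z q = ?d"
    unfolding area_W_def g using pos by simp
  then show "0 < area_W z q" using pos by simp
  show "area_W z q * area_S e1 e2 q x y = det (vector [du z q, dv z q, x, y] :: real^4^4)"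
    if "x \<in> normal_space z q" "y \<in> normal_space z q"
    using gram[OF that] pos unfolding W g by simp
qed

section \<open>Behaviour under a change of parameters\<close>

context
  fixes D D' :: "(real \<times> real) set" and z :: "real \<times> real \<Rightarrow> real^4"
    and \<phi> :: "real \<times> real \<Rightarrow> real \<times> real" and p :: "real \<times> real"
  assumes surface: "regular_surface D z" and change: "change_of_parameters D' D \<phi>" and p: "p \<in> D'"
begin

abbreviation "u_u \<equiv> fst (du \<phi> p)"
abbreviation "u_v \<equiv> fst (dv \<phi> p)"
abbreviation "v_u \<equiv> snd (du \<phi> p)"
abbreviation "v_v \<equiv> snd (dv \<phi> p)"
abbreviation "jac \<equiv> u_u * v_v - u_v * v_u"

lemma jacobian_nonzero: "jac \<noteq> 0"
  using change p by (auto simp: change_of_parameters_def)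

lemma reparam_point_in: "\<phi> p \<in> D"
  using change p by (auto simp: change_of_parameters_def)

lemma du_reparam: "du (z \<circ> \<phi>) p = u_u *\<^sub>R du z (\<phi> p) + v_u *\<^sub>R dv z (\<phi> p)"
  and dv_reparam: "dv (z \<circ> \<phi>) p = u_v *\<^sub>R du z (\<phi> p) + v_v *\<^sub>R dv z (\<phi> p)"
proof -
  have "\<phi> differentiable (at p)" "z differentiable (at (\<phi> p))"
    using surface change p reparam_point_in
    by (auto simp: regular_surface_def change_of_parameters_def intro: smooth_on_differentiable)
  from frechet_derivative_compose_du_dv[OF this]
  show "du (z \<circ> \<phi>) p = u_u *\<^sub>R du z (\<phi> p) + v_u *\<^sub>R dv z (\<phi> p)"
    "dv (z \<circ> \<phi>) p = u_v *\<^sub>R du z (\<phi> p) + v_v *\<^sub>R dv z (\<phi> p)"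
    unfolding du_def[of "z \<circ> \<phi>"] dv_def[of "z \<circ> \<phi>"] du_def[of \<phi>] dv_def[of \<phi>] by blast+
qed

text \<open>The reverse inclusion comes from Cramer's rule.\<close>

lemma tangent_space_reparam: "tangent_space (z \<circ> \<phi>) p = tangent_space z (\<phi> p)"
proof
  show "tangent_space (z \<circ> \<phi>) p \<subseteq> tangent_space z (\<phi> p)"
    unfolding tangent_space_def du_reparam dv_reparam
    by (intro span_minimal subspace_span) (simp add: span_add span_scale span_base)
  let ?a = "du (z \<circ> \<phi>) p" and ?b = "dv (z \<circ> \<phi>) p"
  have "jac *\<^sub>R du z (\<phi> p) = v_v *\<^sub>R ?a - v_u *\<^sub>R ?b" "jac *\<^sub>R dv z (\<phi> p) = u_u *\<^sub>R ?b - u_v *\<^sub>R ?a"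
    unfolding du_reparam dv_reparam by (simp_all add: algebra_simps)
  then have "jac *\<^sub>R du z (\<phi> p) \<in> span {?a, ?b}" "jac *\<^sub>R dv z (\<phi> p) \<in> span {?a, ?b}"
    by (metis insertCI span_base span_diff span_scale)+
  then have "du z (\<phi> p) \<in> span {?a, ?b}" "dv z (\<phi> p) \<in> span {?a, ?b}"
    using jacobian_nonzero by (auto dest: span_scale[where c = "inverse jac"])
  then show "tangent_space z (\<phi> p) \<subseteq> tangent_space (z \<circ> \<phi>) p"
    unfolding tangent_space_def by (intro span_minimal subspace_span) auto
qed

lemma normal_space_reparam: "normal_space (z \<circ> \<phi>) p = normal_space z (\<phi> p)"
  by (simp add: normal_space_def tangent_space_reparam)

text \<open>After projection to the normal plane the second derivatives transform like the coefficients
  of a quadratic form.\<close>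

lemma normal_part_second_derivatives_reparam:
  fixes z\<phi>
  defines "z\<phi> \<equiv> z \<circ> \<phi>" and "n \<equiv> normal_part z (\<phi> p)"
  shows "n (du (du z\<phi>) p) = (u_u * u_u) *\<^sub>R n (du (du z) (\<phi> p)) + (2 * u_u * v_u) *\<^sub>R n (dv (du z) (\<phi> p))
           + (v_u * v_u) *\<^sub>R n (dv (dv z) (\<phi> p))"
    and "n (dv (du z\<phi>) p) = (u_u * u_v) *\<^sub>R n (du (du z) (\<phi> p)) + (u_u * v_v + v_u * u_v) *\<^sub>R n (dv (du z) (\<phi> p))
           + (v_u * v_v) *\<^sub>R n (dv (dv z) (\<phi> p))"
    and "n (dv (dv z\<phi>) p) = (u_v * u_v) *\<^sub>R n (du (du z) (\<phi> p)) + (2 * u_v * v_v) *\<^sub>R n (dv (du z) (\<phi> p))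
           + (v_v * v_v) *\<^sub>R n (dv (dv z) (\<phi> p))"
proof -
  have hyps: "open D" "smooth_on D z" "open D'" "smooth_on D' \<phi>" "\<phi> ` D' \<subseteq> D"
    using surface change by (auto simp: regular_surface_def change_of_parameters_def)
  interpret linear n unfolding n_def by (rule linear_normal_part)
  have n0: "n (c *\<^sub>R du z (\<phi> p) + d *\<^sub>R dv z (\<phi> p)) = 0" for c d
    unfolding n_def by (rule normal_part_tangent) (auto simp: mem_tangent_space)
  have n: "n (k *\<^sub>R x + l *\<^sub>R y + m *\<^sub>R w + c *\<^sub>R du z (\<phi> p) + d *\<^sub>R dv z (\<phi> p))
      = k *\<^sub>R n x + l *\<^sub>R n y + m *\<^sub>R n w" for k l m c d x y w
    using n0[of c d] by (simp add: add scaleR add.assoc)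
  note chain = second_derivative_compose[OF hyps p]
  show "n (du (du z\<phi>) p) = (u_u * u_u) *\<^sub>R n (du (du z) (\<phi> p)) + (2 * u_u * v_u) *\<^sub>R n (dv (du z) (\<phi> p))
      + (v_u * v_u) *\<^sub>R n (dv (dv z) (\<phi> p))"
    by (rule chain[OF Basis_real_pair(1) du_def du_def])
      (simp add: z\<phi>_def du_def[of "z \<circ> \<phi>", abs_def] du_def[of "\<lambda>x. frechet_derivative (z \<circ> \<phi>) (at x) (1, 0)"] n)
  show "n (dv (du z\<phi>) p) = (u_u * u_v) *\<^sub>R n (du (du z) (\<phi> p)) + (u_u * v_v + v_u * u_v) *\<^sub>R n (dv (du z) (\<phi> p))
      + (v_u * v_v) *\<^sub>R n (dv (dv z) (\<phi> p))"
    by (rule chain[OF Basis_real_pair(1) du_def dv_def])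
      (simp add: z\<phi>_def du_def[of "z \<circ> \<phi>", abs_def] dv_def[of "\<lambda>x. frechet_derivative (z \<circ> \<phi>) (at x) (1, 0)"] n)
  show "n (dv (dv z\<phi>) p) = (u_v * u_v) *\<^sub>R n (du (du z) (\<phi> p)) + (2 * u_v * v_v) *\<^sub>R n (dv (du z) (\<phi> p))
      + (v_v * v_v) *\<^sub>R n (dv (dv z) (\<phi> p))"
    by (rule chain[OF Basis_real_pair(2) dv_def dv_def])
      (simp add: z\<phi>_def dv_def[of "z \<circ> \<phi>", abs_def] dv_def[of "\<lambda>x. frechet_derivative (z \<circ> \<phi>) (at x) (0, 1)"] n)
qed

text \<open>The coordinates of tangent vectors transform contragrediently to the
  coefficients of the second fundamental tensor, so its values do not change.\<close>

lemma sff_reparam: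
  assumes W: "area_W z (\<phi> p) \<noteq> 0" and W': "area_W (z \<circ> \<phi>) p \<noteq> 0"
    and "X \<in> tangent_space z (\<phi> p)" and "Y \<in> tangent_space z (\<phi> p)"
  shows "sff (z \<circ> \<phi>) p X Y = sff z (\<phi> p) X Y"
proof -
  obtain l m l' m' where X: "X = l *\<^sub>R du (z \<circ> \<phi>) p + m *\<^sub>R dv (z \<circ> \<phi>) p"
    and Y: "Y = l' *\<^sub>R du (z \<circ> \<phi>) p + m' *\<^sub>R dv (z \<circ> \<phi>) p"
    using assms(3,4) unfolding tangent_space_reparam[symmetric] mem_tangent_space by blast
  have X': "X = (l * u_u + m * u_v) *\<^sub>R du z (\<phi> p) + (l * v_u + m * v_v) *\<^sub>R dv z (\<phi> p)"
    and Y': "Y = (l' * u_u + m' * u_v) *\<^sub>R du z (\<phi> p) + (l' * v_u + m' * v_v) *\<^sub>R dv z (\<phi> p)"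
    unfolding X Y du_reparam dv_reparam by (simp_all add: algebra_simps)
  interpret linear "normal_part z (\<phi> p)" by (rule linear_normal_part)
  have "sff (z \<circ> \<phi>) p X Y = normal_part z (\<phi> p) ((l * l') *\<^sub>R du (du (z \<circ> \<phi>)) p
      + (l * m' + m * l') *\<^sub>R dv (du (z \<circ> \<phi>)) p + (m * m') *\<^sub>R dv (dv (z \<circ> \<phi>)) p)"
    unfolding X Y sff_eq[OF W'] normal_part_cong[OF tangent_space_reparam] ..
  also have "\<dots> = sff z (\<phi> p) X Y"
    unfolding X' Y' sff_eq[OF W]
    by (simp add: add scaleR normal_part_second_derivatives_reparam algebra_simps flip: scaleR_2)
  finally show ?thesis .
qed

lemma sigma_g_reparam:
  assumes "area_W z (\<phi> p) \<noteq> 0" "area_W (z \<circ> \<phi>) p \<noteq> 0"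
    and X: "X \<in> tangent_space z (\<phi> p)" and Y: "Y \<in> tangent_space z (\<phi> p)"
  shows "sigma_g (z \<circ> \<phi>) p X Y = sigma_g z (\<phi> p) X Y"
  using assms sigma_g_eq[of z "\<phi> p" X] sigma_g_eq[of "z \<circ> \<phi>" p X]
  by (simp add: sff_reparam tangent_space_reparam subspace_scale subspace_tangent_space)

lemma area_W_reparam: "(area_W (z \<circ> \<phi>) p)\<^sup>2 = jac\<^sup>2 * (area_W z (\<phi> p))\<^sup>2"
proof -
  let ?g = "first_E z (\<phi> p) * first_G z (\<phi> p) - (first_F z (\<phi> p))\<^sup>2"
  have "first_E (z \<circ> \<phi>) p * first_G (z \<circ> \<phi>) p - (first_F (z \<circ> \<phi>) p)\<^sup>2 = jac\<^sup>2 * ?g"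
    unfolding first_E_def first_F_def first_G_def du_reparam dv_reparam
    by (simp add: inner_simps inner_commute[of "dv z _" "du z _"] power2_eq_square algebra_simps)
  moreover have "0 \<le> ?g"
    unfolding first_E_def first_F_def first_G_def using Cauchy_Schwarz_ineq by simp
  ultimately show ?thesis
    by (simp add: area_W_def)
qed

text \<open>Both sides are determinants, with the coordinate tangent vectors of the two
  parametrizations as first two rows. The frames need not induce the same orientation of the normal
  plane: they differ in orientation exactly when the Jacobian is negative.\<close>

lemma area_S_reparam:
  assumes "oriented_normal_frame D z e1 e2" "oriented_normal_frame D' (z \<circ> \<phi>) e1' e2'"
    and "x \<in> normal_space z (\<phi> p)" "y \<in> normal_space z (\<phi> p)"
  shows "area_W (z \<circ> \<phi>) p * area_S e1' e2' p x y = jac * (area_W z (\<phi> p) * area_S e1 e2 (\<phi> p) x y)"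
  using assms area_W_mult_area_S_eq_det[OF assms(1) reparam_point_in] area_W_mult_area_S_eq_det[OF assms(2) p]
  by (simp add: normal_space_reparam du_reparam dv_reparam det_rows_change_basis)

end

theorem proposition2p1:
  fixes D D' :: "(real \<times> real) set"
    and z :: "real \<times> real \<Rightarrow> real^4"
    and \<phi> :: "real \<times> real \<Rightarrow> real \<times> real"
    and e1 e2 e1' e2' :: "real \<times> real \<Rightarrow> real^4"
    and p' :: "real \<times> real"
    and X1 X2 :: "real^4"
    and l1 m1 l2 m2 :: real
  assumes "regular_surface D z"
    and "oriented_normal_frame D z e1 e2"
    and "\<forall>q\<in>D. \<not> flat_point z e1 e2 q"
    and "change_of_parameters D' D \<phi>"
    and "oriented_normal_frame D' (z \<circ> \<phi>) e1' e2'"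
    and "p' \<in> D'"
    and "X1 = l1 *\<^sub>R du z (\<phi> p') + m1 *\<^sub>R dv z (\<phi> p')" and "X1 \<noteq> 0"
    and "X2 = l2 *\<^sub>R du z (\<phi> p') + m2 *\<^sub>R dv z (\<phi> p')" and "X2 \<noteq> 0"
  shows "zeta (z \<circ> \<phi>) e1' e2' p' X1 X2 = zeta z e1 e2 (\<phi> p') X1 X2"
proof -
  note reparam = assms(1,4,6)
  let ?q = "\<phi> p'"
  let ?a = "du z ?q" and ?b = "dv z ?q" and ?a' = "du (z \<circ> \<phi>) p'" and ?b' = "dv (z \<circ> \<phi>) p'"
  let ?\<sigma>1 = "sigma_g z ?q X1" and ?\<sigma>2 = "sigma_g z ?q X2"
  let ?S = "area_S e1 e2 ?q" and ?S' = "area_S e1' e2' p'"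
  define J where "J = fst (du \<phi> p') * snd (dv \<phi> p') - fst (dv \<phi> p') * snd (du \<phi> p')"
  define W where "W = area_W z ?q"
  define W' where "W' = area_W (z \<circ> \<phi>) p'"
  have "J \<noteq> 0"
    unfolding J_def by (rule jacobian_nonzero[OF reparam])
  have "0 < W" "0 < W'"
    unfolding W_def W'_def using area_W_pos reparam_point_in[OF reparam] assms by metis+
  then have W: "area_W z ?q \<noteq> 0" "area_W (z \<circ> \<phi>) p' \<noteq> 0"
    by (simp_all add: W_def W'_def)
  have tangent: "X1 \<in> tangent_space z ?q" "X2 \<in> tangent_space z ?q"
      "?a' \<in> tangent_space z ?q" "?b' \<in> tangent_space z ?q"
    using assms(7,9) du_reparam[OF reparam] dv_reparam[OF reparam] mem_tangent_space by blast+
  have linear: "sigma_g z ?q X (l *\<^sub>R ?a + m *\<^sub>R ?b) = l *\<^sub>R sigma_g z ?q X ?a + m *\<^sub>R sigma_g z ?q X ?b"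
    if "X \<in> tangent_space z ?q" for X l m
    using that W(1) by (simp add: sigma_g_eq sff_add_scale_right subspace_scale subspace_tangent_space)
  have normal: "sigma_g z ?q X Y \<in> normal_space z ?q" for X Y
    by (simp add: sigma_g_def sff_in_normal_space)
  have S': "?S' (sigma_g z ?q X Y) (sigma_g z ?q X' Y')
      = J * W / W' * ?S (sigma_g z ?q X Y) (sigma_g z ?q X' Y')" for X Y X' Y'
    using area_S_reparam[OF reparam assms(2,5) normal normal, of X Y X' Y'] \<open>0 < W'\<close>
    by (simp add: J_def W_def W'_def field_simps)
  have "zeta (z \<circ> \<phi>) e1' e2' p' X1 X2 = (?S' (?\<sigma>1 ?a') (?\<sigma>2 ?b') + ?S' (?\<sigma>2 ?a') (?\<sigma>1 ?b')) / W'"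
    unfolding zeta_def W'_def by (simp add: sigma_g_reparam[OF reparam W] tangent add_divide_distrib)
  also have "\<dots> = J * W / W'\<^sup>2 * (?S (?\<sigma>1 ?a') (?\<sigma>2 ?b') + ?S (?\<sigma>2 ?a') (?\<sigma>1 ?b'))"
    unfolding S' using \<open>0 < W'\<close> by (simp add: power2_eq_square field_simps)
  \<comment> \<open>The sum is symmetric in the two tangents while \<open>S\<close> is alternating, so the terms with \<open>\<sigma>1 ?a\<close>, \<open>\<sigma>2 ?a\<close>
    and those with \<open>\<sigma>1 ?b\<close>, \<open>\<sigma>2 ?b\<close> cancel and only the determinant of the coefficients remains.\<close>
  also have "?S (?\<sigma>1 ?a') (?\<sigma>2 ?b') + ?S (?\<sigma>2 ?a') (?\<sigma>1 ?b')
      = J * (?S (?\<sigma>1 ?a) (?\<sigma>2 ?b) + ?S (?\<sigma>2 ?a) (?\<sigma>1 ?b))"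
    unfolding du_reparam[OF reparam] dv_reparam[OF reparam] linear[OF tangent(1)] linear[OF tangent(2)] J_def
    by (simp add: area_S_def inner_simps algebra_simps)
  also have "J * W / W'\<^sup>2 * (J * (?S (?\<sigma>1 ?a) (?\<sigma>2 ?b) + ?S (?\<sigma>2 ?a) (?\<sigma>1 ?b)))
      = (?S (?\<sigma>1 ?a) (?\<sigma>2 ?b) + ?S (?\<sigma>2 ?a) (?\<sigma>1 ?b)) / W"
  proof -
    have "W'\<^sup>2 = J\<^sup>2 * W\<^sup>2"
      unfolding W'_def W_def J_def by (rule area_W_reparam[OF reparam])
    then show ?thesis
      using \<open>J \<noteq> 0\<close> \<open>0 < W\<close> by (simp add: power2_eq_square)
  qed
  also have "\<dots> = zeta z e1 e2 ?q X1 X2"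
    unfolding zeta_def W_def by (simp add: add_divide_distrib)
  finally show ?thesis .
qed

end
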